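(* Let $q$ be a prime power, let $a$ be a positive integer and let $n=2a$. There exists a family $\mathcal F\subseteq\mathbb F_q^{n\times n}$ with $|\mathcal F|=q^{2a^2}$ such that $\dim\ker(A-B)$ is even for all $A,B\in\mathcal F$. In particular, $\mathcal F$ is $(t-1)$-intersection-free for every even positive integer $t\le n$; and if moreover $t\ge (n+1)/2$, then $\mathcal F$ is strictly larger than every $t$-umvirate of $\mathbb F_q^{n\times n}$ (these have size $q^{(2a)^2-2at}$).
   Context: A family $\mathcal F\subseteq\mathbb F_q^{n\times n}$ is $(t-1)$-intersection-free if $\dim\ker(A-B)\ne t-1$ for all $A,B\in\mathcal F$. A $t$-umvirate of $\mathbb F_q^{n\times n}$ is a family $\{A: Av_i=w_i,\ 1\le i\le t\}$ with $v_1,\dots,v_t\in\mathbb F_q^n$ linearly independent and $w_1,\dots,w_t\in\mathbb F_q^n$ arbitrary. *)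

theory Defs
  imports "HOL-Analysis.Analysis"
begin

(* A field with q elements is a type 'k of sort {field, finite} with CARD('k) = q;
   n is CARD('n), so square matrices of order n over it are elements of 'k^'n^'n.
   vec.dim and vec.independent are dimension and linear independence over 'k
   (dim and independent are the notions over the reals). *)

definition mat_ker :: "'k::field^'n^'m \<Rightarrow> ('k^'n) set" where
  "mat_ker M = {x. M *v x = 0}"

definition intersection_free :: "nat \<Rightarrow> ('k::field^'n^'n) set \<Rightarrow> bool" where
  "intersection_free s F \<longleftrightarrow> (\<forall>A\<in>F. \<forall>B\<in>F. vec.dim (mat_ker (A - B)) \<noteq> s)"

(* Injectivity is needed since vec.independent speaks about sets, not about families. *)
definition independent_family :: "nat \<Rightarrow> (nat \<Rightarrow> 'k::field^'n) \<Rightarrow> bool" where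
  "independent_family t v \<longleftrightarrow> inj_on v {1..t} \<and> vec.independent (v ` {1..t})"

definition umvirate :: "nat \<Rightarrow> ('k::field^'n^'n) set \<Rightarrow> bool" where
  "umvirate t U \<longleftrightarrow>
     (\<exists>v w. independent_family t v \<and> U = {A. \<forall>i\<in>{1..t}. A *v v i = w i})"

end

theory Submission
  imports Defs
begin

text \<open>
  The matrices with coefficients in the field with \<open>q\<^sup>2\<close> elements form the family: identify
  the space of column vectors with an \<open>a\<close>-dimensional space over the quadratic extension and
  take the maps that are linear over the extension. There are \<open>(q\<^sup>2) ^ (a\<^sup>2)\<close> of them, a
  difference of two is again such a map, and its kernel, being a space over the extension, has
  even dimension over the small field.

  The extension field itself is never constructed. Choose \<open>c\<close> such that \<open>X\<^sup>2 + X - c\<close> has no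
  root; then a linear operator \<open>J\<close> with \<open>J\<^sup>2 + J = c\<close> plays the role of multiplication by a
  generator of the extension, subspaces over the extension are the subspaces invariant under
  \<open>J\<close>, and maps linear over the extension are the matrices commuting with \<open>J\<close>. The lemma
  \<open>even_dim_if_invariant\<close> gives the parity, and \<open>ex_large_commutant\<close> gives the operator and
  the family.

  A \<open>t\<close>-umvirate prescribes a linear map on \<open>t\<close> vectors of a basis and leaves it free on the
  other \<open>n - t\<close>, which determines its size (\<open>card_umvirate\<close>). Comparing exponents,
  \<open>4 * a\<^sup>2 - 2 * a * t < 2 * a\<^sup>2\<close> holds exactly when \<open>t > a\<close>.
\<close>

section \<open>Even dimensions from a quadratic operator without eigenvalues\<close>

text \<open>
  A monic quadratic of the form \<open>X\<^sup>2 + X - c\<close> serves in every characteristic, whereas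
  \<open>X\<^sup>2 - c\<close> would have a root for every \<open>c\<close> in a finite field of characteristic two. The map \<open>r \<mapsto> r\<^sup>2 + r\<close> identifies
  \<open>0\<close> and \<open>-1\<close>, so on a finite field it misses a value.
\<close>

lemma finite_field_ex_irreducible_quadratic:
  "\<exists>c::'k::{field,finite}. \<forall>r. r * r + r \<noteq> c"
proof (rule ccontr)
  assume "\<not> ?thesis"
  then have "\<exists>r. c = r * r + r" for c :: 'k
    by (blast intro: sym)
  then have "surj (\<lambda>r::'k. r * r + r)"
    unfolding surj_def by blast
  then have "inj (\<lambda>r::'k. r * r + r)"
    by (rule finite_UNIV_surj_inj[OF finite])
  from injD[OF this, of 0 "- 1"] show False by simp
qed

text \<open>
  An invariant subspace is a vector space over the quadratic extension generated by \<open>f\<close>. The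
  proof avoids the extension: an invariant subspace \<open>U\<close> of even dimension that is not yet all
  of \<open>W\<close> is enlarged by \<open>v\<close> and \<open>f v\<close> for some \<open>v\<close> outside \<open>U\<close>. This adds exactly two
  dimensions, since otherwise \<open>v\<close> would be an eigenvector modulo \<open>U\<close> and its eigenvalue a
  root of the quadratic.
\<close>

lemma even_dim_if_invariant:
  fixes f :: "'k::field^'n \<Rightarrow> 'k^'n"
  assumes lin: "Vector_Spaces.linear (*s) (*s) f"
    and quad: "\<And>x. f (f x) = c *s x - f x"
    and no_root: "\<And>r. r * r + r \<noteq> c"
    and W: "vec.subspace W" and inv: "\<And>x. x \<in> W \<Longrightarrow> f x \<in> W"
  shows "even (vec.dim W)"
proof -
  interpret f: Vector_Spaces.linear "(*s)" "(*s)" f by (rule lin)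
  have main: "even (vec.dim W)"
    if "vec.subspace U" "U \<subseteq> W" "\<And>x. x \<in> U \<Longrightarrow> f x \<in> U" "even (vec.dim U)" for U
    using that
  proof (induction "vec.dim W - vec.dim U" arbitrary: U rule: less_induct)
    case less
    show ?case
    proof (cases "U = W")
      case True
      with less.prems show ?thesis by simp
    next
      case False
      then obtain v where v: "v \<in> W" "v \<notin> U" using less.prems by auto
      have span_U: "vec.span U = U" using less.prems(1) by simp
      have vU: "v \<notin> vec.span U" unfolding span_U by (rule v(2))
      have fv: "f v \<notin> vec.span (insert v U)"
      proof
        assume "f v \<in> vec.span (insert v U)"
        then obtain r where "f v - r *s v \<in> U"
          unfolding vec.span_breakdown_eq span_U by blast
        then obtain u where u: "u \<in> U" and fv: "f v = u + r *s v"
          by (metis diff_add_cancel)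
        \<comment> \<open>Evaluating the quadratic at the eigenvector \<open>v\<close> modulo \<open>U\<close> puts a nonzero multiple
          of \<open>v\<close> into \<open>U\<close>.\<close>
        have "f (f v) = f u + r *s f v"
          by (simp only: fv f.add f.scale)
        then have "(c - (r * r + r)) *s v = f u + r *s u + u"
          using quad[of v]
          by (simp add: fv vec.scale_left_diff_distrib vec.scale_left_distrib
                vec.scale_right_distrib algebra_simps)
        also have "\<dots> \<in> U"
          using u less.prems(1,3) by (intro vec.subspace_add vec.subspace_scale) auto
        finally have "(c - (r * r + r)) *s v \<in> U" .
        then have "inverse (c - (r * r + r)) *s ((c - (r * r + r)) *s v) \<in> U"
          by (rule vec.subspace_scale[OF less.prems(1)])
        moreover have "c - (r * r + r) \<noteq> 0" using no_root[of r] by simp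
        ultimately have "v \<in> U"
          by (simp only: vec.scale_scale left_inverse vec.scale_one not_False_eq_True)
        with v(2) show False by simp
      qed
      define U' where "U' = vec.span (insert (f v) (insert v U))"
      have dim: "vec.dim U' = vec.dim U + 2"
        using fv vU by (simp add: U'_def vec.dim_insert)
      have sub: "U' \<subseteq> W"
        unfolding U'_def using v less.prems inv W by (intro vec.span_minimal) auto
      have base: "insert (f v) (insert v U) \<subseteq> U'"
        unfolding U'_def by (rule vec.span_superset)
      have subU': "vec.subspace U'" unfolding U'_def by simp
      have "f (f v) \<in> U'"
        unfolding quad using base subU' by (intro vec.subspace_diff vec.subspace_scale) auto
      then have "insert (f v) (insert v U) \<subseteq> {x. f x \<in> U'}"
        using base less.prems(3) by auto
      moreover have "vec.subspace {x. f x \<in> U'}"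
        by (rule f.subspace_vimage[OF subU', unfolded vimage_def])
      ultimately have "f x \<in> U'" if "x \<in> U'" for x
        using that unfolding U'_def by (metis (no_types, lifting) mem_Collect_eq subsetD vec.span_minimal)
      moreover have "vec.dim U' \<le> vec.dim W" using sub by (rule vec.dim_subset)
      then have "vec.dim W - vec.dim U' < vec.dim W - vec.dim U" using dim by linarith
      ultimately show ?thesis
        using less.hyps[of U'] subU' sub dim less.prems(4) by auto
    qed
  qed
  show ?thesis
    by (rule main[of "{0}"]) (use W in \<open>auto simp: vec.subspace_0 f.zero\<close>)
qed

section \<open>A large space of matrices commuting with such an operator\<close>

lemma ex_swapping_involution:
  assumes "CARD('n::finite) = 2 * a"
  shows "\<exists>(I :: 'n set) s. card I = a \<and> (\<forall>k. s (s k) = k) \<and> (\<forall>k. s k \<in> I \<longleftrightarrow> k \<notin> I)"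
proof -
  obtain I :: "'n set" where I: "card I = a"
    using obtain_subset_with_card_n[of a "UNIV :: 'n set"] assms by auto
  have "card (- I) = a" using I assms by (simp add: Compl_eq_Diff_UNIV card_Diff_subset)
  then obtain p where p: "bij_betw p I (- I)"
    using finite_same_card_bij[of I "- I"] I by auto
  define s where "s = (\<lambda>k. if k \<in> I then p k else inv_into I p k)"
  have pI: "p k \<notin> I" if "k \<in> I" for k using bij_betwE[OF p] that by auto
  have iI: "inv_into I p k \<in> I" if "k \<notin> I" for k
    using bij_betwE[OF bij_betw_inv_into[OF p]] that by auto
  have "s (s k) = k" for k
    unfolding s_def
    by (cases "k \<in> I")
      (simp_all add: pI iI bij_betw_inv_into_left[OF p] bij_betw_inv_into_right[OF p])
  moreover have "s k \<in> I \<longleftrightarrow> k \<notin> I" for k by (simp add: s_def pI iI)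
  ultimately show ?thesis using I by blast
qed

text \<open>
  With \<open>e\<^sub>k\<close> the standard basis, the operator \<open>J\<close> sends \<open>e\<^sub>i\<close> to \<open>e\<^bsub>s i\<^esub>\<close> for \<open>i \<in> I\<close>, so it is
  a direct sum of \<open>a\<close> companion matrices of \<open>X\<^sup>2 + X - c\<close>. The \<open>e\<^sub>i\<close> with \<open>i \<in> I\<close> are then a
  basis over the extension, and a map commuting with \<open>J\<close> may send them anywhere: \<open>L g\<close> is the
  one that sends \<open>e\<^sub>i\<close> to \<open>g i\<close>, hence \<open>e\<^bsub>s i\<^esub>\<close> to \<open>J (g i)\<close>. There are
  \<open>(q ^ (2 * a)) ^ a\<close> choices of \<open>g\<close>.
\<close>

lemma ex_large_commutant:
  fixes c :: "'k::{field,finite}"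
  assumes "CARD('n::finite) = 2 * a"
  shows "\<exists>(J :: 'k^'n \<Rightarrow> 'k^'n) (F :: ('k^'n^'n) set).
    Vector_Spaces.linear (*s) (*s) J \<and> (\<forall>x. J (J x) = c *s x - J x) \<and>
    (\<forall>A\<in>F. \<forall>x. A *v J x = J (A *v x)) \<and> card F = CARD('k) ^ (2 * a\<^sup>2)"
proof -
  obtain I :: "'n set" and s where I: "card I = a" and ss: "\<And>k. s (s k) = k"
    and sI: "\<And>k. s k \<in> I \<longleftrightarrow> k \<notin> I"
    using ex_swapping_involution[OF assms] by blast
  define J :: "'k^'n \<Rightarrow> 'k^'n"
    where "J x = (\<chi> k. if k \<in> I then c * x $ s k else x $ s k - x $ k)" for x
  have linJ: "Vector_Spaces.linear (*s) (*s) J"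
    by (rule Vector_Spaces.linear_iff[THEN iffD2]) (auto simp: vec.vector_space_axioms J_def vec_eq_iff algebra_simps)
  interpret J: Vector_Spaces.linear "(*s)" "(*s)" J by (rule linJ)
  have JJ: "J (J x) = c *s x - J x" for x
    by (auto simp: J_def vec_eq_iff ss sI algebra_simps)
  define L :: "('n \<Rightarrow> 'k^'n) \<Rightarrow> 'k^'n \<Rightarrow> 'k^'n"
    where "L g x = (\<Sum>i\<in>I. x $ i *s g i + x $ s i *s J (g i))" for g x
  have linL: "Vector_Spaces.linear (*s) (*s) (L g)" for g
    unfolding L_def
    by (rule Vector_Spaces.linear_iff[THEN iffD2])
      (auto simp: vec.vector_space_axioms vec.scale_left_distrib vec.scale_right_distrib vec.scale_sum_right sum.distrib
        algebra_simps)
  have LJ: "L g (J x) = J (L g x)" for g x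
    unfolding L_def J.sum
    by (rule sum.cong)
      (auto simp: J_def[of x] J.add J.scale JJ sI ss vec_eq_iff algebra_simps)
  have L_axis: "L g (axis i 1) = g i" if "i \<in> I" for g i
  proof -
    have "L g (axis i 1) = (\<Sum>j\<in>I. if j = i then g j else 0)"
      unfolding L_def
    proof (rule sum.cong)
      fix j assume "j \<in> I"
      then have "s j \<noteq> i" using sI that by metis
      then show "axis i 1 $ j *s g j + axis i 1 $ s j *s J (g j) = (if j = i then g j else 0)"
        by (auto simp: axis_def)
    qed simp
    with that show ?thesis by simp
  qed
  define F where "F = (\<lambda>g. matrix (L g)) ` (PiE I (\<lambda>_. UNIV))"
  have mv: "matrix (L g) *v x = L g x" for g x by (rule matrix_works[OF linL])
  have "inj_on (\<lambda>g. matrix (L g)) (PiE I (\<lambda>_. UNIV))"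
  proof (rule inj_onI, rule PiE_ext)
    fix g h i assume "matrix (L g) = matrix (L h)" "i \<in> I"
    then show "g i = h i" by (metis mv L_axis)
  qed
  then have "card F = CARD('k ^ 'n) ^ a"
    unfolding F_def by (simp add: card_image card_PiE I)
  also have "\<dots> = CARD('k) ^ (2 * a\<^sup>2)"
    by (simp add: assms power_mult[symmetric] power2_eq_square mult.assoc)
  finally have "card F = CARD('k) ^ (2 * a\<^sup>2)" .
  moreover have "\<forall>A\<in>F. \<forall>x. A *v J x = J (A *v x)"
    by (auto simp: F_def mv LJ)
  ultimately show ?thesis using linJ JJ by blast
qed

lemma even_dim_mat_ker_if_commute:
  fixes A :: "'k::field^'n^'n"
  assumes lin: "Vector_Spaces.linear (*s) (*s) J"
    and quad: "\<And>x. J (J x) = c *s x - J x"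
    and no_root: "\<And>r. r * r + r \<noteq> c"
    and comm: "\<And>x. A *v J x = J (A *v x)"
  shows "even (vec.dim (mat_ker A))"
proof -
  interpret J: Vector_Spaces.linear "(*s)" "(*s)" J by (rule lin)
  have "vec.subspace (mat_ker A)"
    unfolding mat_ker_def by (rule vec.subspace_kernel)
  then show ?thesis
    by (rule even_dim_if_invariant[OF lin quad no_root]) (simp add: mat_ker_def comm J.zero)
qed

section \<open>The size of an umvirate\<close>

text \<open>
  After extending the prescribed vectors to a basis \<open>B\<close>, a member of the umvirate is given by
  arbitrary values on the remaining basis vectors. Independence forces \<open>t \<le> n\<close>, so the
  subtraction in the exponent is never truncated.
\<close>

lemma card_umvirate:
  fixes U :: "('k::{field,finite}^'n^'n) set"
  assumes "umvirate t U"
  shows "card U = CARD('k) ^ (CARD('n) * (CARD('n) - t))"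
proof -
  obtain v w where v: "inj_on v {1..t}" "vec.independent (v ` {1..t})"
    and U: "U = {A. \<forall>i\<in>{1..t}. A *v v i = w i}"
    using assms unfolding umvirate_def independent_family_def by blast
  define V where "V = v ` {1..t}"
  define B where "B = vec.extend_basis V"
  have B: "V \<subseteq> B" "vec.independent B" "vec.span B = UNIV"
    using v(2) vec.extend_basis_superset vec.independent_extend_basis vec.span_extend_basis
    unfolding B_def V_def by auto
  have "card B = CARD('n)"
    using vec.dim_eq_card_independent[OF B(2)] vec.dim_span[of B] B(3) vec_dim_card by metis
  moreover have "card V = t" using v(1) by (simp add: V_def card_image)
  ultimately have card: "card (B - V) = CARD('n) - t"
    using B(1) by (simp add: card_Diff_subset)
  have "bij_betw (\<lambda>A. restrict ((*v) A) (B - V)) U (PiE (B - V) (\<lambda>_. UNIV))"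
    unfolding bij_betw_def
  proof (intro conjI inj_onI subset_antisym subsetI)
    fix A A' assume A: "A \<in> U" "A' \<in> U"
      and eq: "restrict ((*v) A) (B - V) = restrict ((*v) A') (B - V)"
    have "A *v b = A' *v b" if "b \<in> B" for b
    proof (cases "b \<in> V")
      case True
      then show ?thesis using A unfolding U V_def by auto
    next
      case False
      then show ?thesis using that fun_cong[OF eq, of b] by simp
    qed
    then have "A *v x = A' *v x" for x
      using vec.linear_eq_on[OF matrix_vector_mul_linear_gen matrix_vector_mul_linear_gen, of x B A A'] B(3)
      by auto
    then show "A = A'" by (simp add: matrix_eq)
  next
    fix g assume g: "g \<in> PiE (B - V) (\<lambda>_. UNIV :: ('k^'n) set)"
    obtain h where h: "Vector_Spaces.linear (*s) (*s) h"
      "\<And>b. b \<in> B \<Longrightarrow> h b = (if b \<in> V then w (inv_into {1..t} v b) else g b)"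
      using vec.linear_independent_extend[OF B(2),
          of "\<lambda>b. if b \<in> V then w (inv_into {1..t} v b) else g b"] by blast
    have m: "matrix h *v x = h x" for x by (rule matrix_works[OF h(1)])
    have "h (v i) = w i" if "i \<in> {1..t}" for i
    proof -
      have "v i \<in> V" using that by (simp add: V_def)
      then show ?thesis using h(2)[of "v i"] B(1) inv_into_f_f[OF v(1) that] by auto
    qed
    then have "matrix h \<in> U" by (simp add: U m)
    moreover have "restrict ((*v) (matrix h)) (B - V) = g"
      by (rule ext) (use g in \<open>simp add: restrict_def m h(2) PiE_def extensional_def\<close>)
    ultimately show "g \<in> (\<lambda>A. restrict ((*v) A) (B - V)) ` U" by blast
  qed (auto split: if_splits)
  then have "card U = CARD('k ^ 'n) ^ (CARD('n) - t)"
    by (simp add: bij_betw_same_card card_PiE card)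
  then show ?thesis by (simp only: CARD_vec power_mult)
qed

theorem mainTheorem4:
  fixes q a n :: nat
  assumes "CARD('k::{field,finite}) = q"
    and "a > 0"
    and "n = 2 * a"
    and "CARD('n::finite) = n"
  shows "(\<exists>F :: ('k^'n^'n) set.
           card F = q ^ (2 * a\<^sup>2) \<and>
           (\<forall>A\<in>F. \<forall>B\<in>F. even (vec.dim (mat_ker (A - B)))) \<and>
           (\<forall>t. even t \<and> 0 < t \<and> t \<le> n \<longrightarrow>
              intersection_free (t - 1) F \<and>
              (real t \<ge> (real n + 1) / 2 \<longrightarrow>
                 (\<forall>U :: ('k^'n^'n) set. umvirate t U \<longrightarrow> card U < card F)))) \<and>
         (\<forall>t. 0 < t \<and> t \<le> n \<longrightarrow>
            (\<forall>U :: ('k^'n^'n) set. umvirate t U \<longrightarrow> card U = q ^ ((2 * a)\<^sup>2 - 2 * a * t)))"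
proof -
  have n: "CARD('n) = 2 * a" using assms by simp
  have cardU: "card U = q ^ ((2 * a)\<^sup>2 - 2 * a * t)"
    if "umvirate t U" for t and U :: "('k^'n^'n) set"
    using card_umvirate[OF that] by (simp add: n assms(1) power2_eq_square diff_mult_distrib2)
  obtain c :: 'k where c: "\<And>r. r * r + r \<noteq> c"
    using finite_field_ex_irreducible_quadratic by blast
  obtain J and F :: "('k^'n^'n) set" where J: "Vector_Spaces.linear (*s) (*s) J"
      "\<And>x. J (J x) = c *s x - J x"
    and comm: "\<And>A x. A \<in> F \<Longrightarrow> A *v J x = J (A *v x)" and cardF: "card F = q ^ (2 * a\<^sup>2)"
    using ex_large_commutant[OF n, of c] assms(1) by blast
  interpret J: Vector_Spaces.linear "(*s)" "(*s)" J by (rule J(1))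
  have ev: "even (vec.dim (mat_ker (A - B)))" if "A \<in> F" "B \<in> F" for A B
    by (rule even_dim_mat_ker_if_commute[OF J c])
      (simp add: matrix_vector_mult_diff_rdistrib comm that J.diff)
  have free: "intersection_free (t - 1) F" if "even t" "0 < t" for t
    unfolding intersection_free_def
  proof (intro ballI notI)
    fix A B assume "A \<in> F" "B \<in> F" "vec.dim (mat_ker (A - B)) = t - 1"
    then have "even (t - 1)" using ev by metis
    with that show False by simp
  qed
  have smaller: "card U < card F"
    if "real t \<ge> (real n + 1) / 2" "umvirate t U" for t and U :: "('k^'n^'n) set"
  proof -
    have "card {0, 1 :: 'k} \<le> q" unfolding assms(1)[symmetric] by (rule card_mono) auto
    then have q: "1 < q" by simp
    have "real n + 1 \<le> 2 * real t" using that(1) by simp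
    then have "a < t" using assms(3) by linarith
    then have "a\<^sup>2 < a * t" "0 < a\<^sup>2" using assms(2) by (simp_all add: power2_eq_square)
    moreover have "(2 * a)\<^sup>2 = 4 * a\<^sup>2" "2 * a * t = 2 * (a * t)" by simp_all
    ultimately have "(2 * a)\<^sup>2 - 2 * a * t < 2 * a\<^sup>2" by linarith
    then show ?thesis unfolding cardU[OF that(2)] cardF using q by (rule power_strict_increasing)
  qed
  show ?thesis using cardF ev free smaller cardU by blast
qed

end
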